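(* Let $t\in\mathbb{R}\setminus\mathbb{Z}_{\ge0}$ and $r>0$. The pair $(\mathcal{A}_{r,H}^{(t)},\boxplus^H_t)$, with norm $\|\cdot\|_{r,t}$, is a unital commutative Banach algebra, and $$\Phi_t^H:(\mathcal{A}_{r,H}^{(t)},\boxplus^H_t)\longrightarrow(\mathcal{A}_r,\cdot)$$ is an isometric algebra isomorphism.
   Context: $\mathbb{N}=\{0,1,2,\dots\}$. $H\mathbb{R}$ is the set of all maps $f:\mathbb{N}\to\mathbb{R}$. $(t)_{\underline{0}}=1$, $(t)_{\underline{n}}=t(t-1)\cdots(t-n+1)$ for $n\ge1$. $(f\boxplus^H_tg)(n)=\sum_{i+j=n}\frac{(t)_{\underline{n}}}{(t)_{\underline{i}}(t)_{\underline{j}}}f(i)g(j)$, and $\Phi_t^H(f)(z)=\sum_{n\ge0}\frac{f(n)}{(t)_{\underline{n}}}z^n$. $\mathcal{A}_{r,H}^{(t)}=\{f\in H\mathbb{R}:\|f\|_{r,t}:=\sum_{n\ge0}|f(n)/(t)_{\underline{n}}|\,r^n<\infty\}$. $\mathcal{A}_r=\{F(z)=\sum_{n\ge0}a_nz^n\ (a_n\in\mathbb{R}):\|F\|_r:=\sum_{n\ge0}|a_n|r^n<\infty\}$ is the weighted Wiener algebra, with the Cauchy product of power series. *)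

theory Defs
  imports
    "HOL-Algebra.Algebraic_Closure_Type"
    "HOL-Algebra.Module"
    "HOL-Algebra.QuotRing"
    "HOL-Analysis.Abstract_Metric_Spaces"
    "HOL-Computational_Algebra.Formal_Power_Series"
begin

section \<open>Unital commutative Banach algebras on an explicit carrier\<close>

text \<open>The carriers below depend on the real parameters \<open>t\<close> and \<open>r\<close>, so the type classes
  of normed algebras are not available.\<close>

record 'a normed_alg = "(real, 'a) module" +
  nrm :: "'a \<Rightarrow> real"  (\<open>(\<open>open_block notation=\<open>mixfix nrm\<close>\<close>\<parallel>_\<parallel>\<index>)\<close>)

locale comm_normed_algebra =
  algebra "ring_of_type_algebra :: real ring" A
  for A :: "('a, 'b) normed_alg_scheme" (structure) +
  assumes nrm_nonneg: "x \<in> carrier A \<Longrightarrow> 0 \<le> \<parallel>x\<parallel>"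
    and nrm_eq_0_iff: "x \<in> carrier A \<Longrightarrow> \<parallel>x\<parallel> = 0 \<longleftrightarrow> x = \<zero>"
    and nrm_triangle: "\<lbrakk>x \<in> carrier A; y \<in> carrier A\<rbrakk> \<Longrightarrow> \<parallel>x \<oplus> y\<parallel> \<le> \<parallel>x\<parallel> + \<parallel>y\<parallel>"
    and nrm_smult: "x \<in> carrier A \<Longrightarrow> \<parallel>c \<odot> x\<parallel> = \<bar>c\<bar> * \<parallel>x\<parallel>"
    and nrm_mult: "\<lbrakk>x \<in> carrier A; y \<in> carrier A\<rbrakk> \<Longrightarrow> \<parallel>x \<otimes> y\<parallel> \<le> \<parallel>x\<parallel> * \<parallel>y\<parallel>"
    and nrm_one: "\<parallel>\<one>\<parallel> = 1"
begin

text \<open>A \<open>Metric_space\<close> distance must be nonnegative and symmetric on the whole type, so the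
  norm distance is cut off outside the carrier.\<close>

definition nrm_dist :: "'a \<Rightarrow> 'a \<Rightarrow> real"
  where "nrm_dist x y = (if x \<in> carrier A \<and> y \<in> carrier A then \<parallel>x \<ominus> y\<parallel> else 0)"

lemma nrm_a_inv:
  assumes x: "x \<in> carrier A"
  shows "\<parallel>\<ominus> x\<parallel> = \<parallel>x\<parallel>"
proof -
  let ?R = "ring_of_type_algebra :: real ring"
  have "\<ominus>\<^bsub>?R\<^esub> (1::real) = -1"
    by (rule R.minus_equality) (auto simp: ring_of_type_algebra_def)
  moreover have "\<one>\<^bsub>?R\<^esub> = (1::real)"
    by (simp add: ring_of_type_algebra_def)
  ultimately have "\<ominus> x = (-1::real) \<odot> x"
    using smult_l_minus[of "1::real" x] smult_one[OF x] x
    by (simp add: ring_of_type_algebra_def)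
  then show ?thesis
    using nrm_smult[OF x, of "-1"] by simp
qed

lemma Metric_space_nrm_dist: "Metric_space (carrier A) nrm_dist"
proof
  fix x y z
  show "0 \<le> nrm_dist x y"
    by (simp add: nrm_dist_def nrm_nonneg)
  show "nrm_dist x y = nrm_dist y x"
  proof (cases "x \<in> carrier A \<and> y \<in> carrier A")
    case True
    then have "x \<ominus> y = \<ominus> (y \<ominus> x)"
      by (simp add: a_minus_def M.minus_add M.a_comm)
    with True show ?thesis
      by (simp add: nrm_dist_def nrm_a_inv)
  qed (auto simp: nrm_dist_def)
  show "nrm_dist x y = 0 \<longleftrightarrow> x = y" if "x \<in> carrier A" "y \<in> carrier A"
    using that by (simp add: nrm_dist_def nrm_eq_0_iff)
  show "nrm_dist x z \<le> nrm_dist x y + nrm_dist y z"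
    if "x \<in> carrier A" "y \<in> carrier A" "z \<in> carrier A"
  proof -
    have "x \<ominus> z = (x \<ominus> y) \<oplus> (y \<ominus> z)"
      using that by (simp add: a_minus_def M.a_assoc M.r_neg1)
    with that nrm_triangle[of "x \<ominus> y" "y \<ominus> z"] show ?thesis
      by (simp add: nrm_dist_def)
  qed
qed

sublocale Metric_space "carrier A" nrm_dist
  by (rule Metric_space_nrm_dist)

end

locale comm_banach_algebra = comm_normed_algebra +
  assumes complete: "mcomplete"

definition isometric_algebra_iso ::
  "('a, 'c) normed_alg_scheme \<Rightarrow> ('b, 'd) normed_alg_scheme \<Rightarrow> ('a \<Rightarrow> 'b) set"
  where "isometric_algebra_iso A B =
    {h \<in> ring_iso A B.
      (\<forall>c. \<forall>x\<in>carrier A. h (c \<odot>\<^bsub>A\<^esub> x) = c \<odot>\<^bsub>B\<^esub> h x) \<and>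
      (\<forall>x\<in>carrier A. \<parallel>h x\<parallel>\<^bsub>B\<^esub> = \<parallel>x\<parallel>\<^bsub>A\<^esub>)}"

section \<open>The algebra of sequences with the twisted convolution\<close>

definition falling_fact :: "real \<Rightarrow> nat \<Rightarrow> real"
  where "falling_fact t n = (\<Prod>i<n. t - real i)"

definition boxplus :: "real \<Rightarrow> (nat \<Rightarrow> real) \<Rightarrow> (nat \<Rightarrow> real) \<Rightarrow> (nat \<Rightarrow> real)"
  where "boxplus t f g = (\<lambda>n. \<Sum>i\<le>n.
    falling_fact t n / (falling_fact t i * falling_fact t (n - i)) * f i * g (n - i))"

definition Phi :: "real \<Rightarrow> (nat \<Rightarrow> real) \<Rightarrow> real fps"
  where "Phi t f = Abs_fps (\<lambda>n. f n / falling_fact t n)"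

text \<open>The vector space operations are pointwise and the unit is the indicator of \<open>0\<close>.
  On the carrier the series defining the norm converges, so its \<open>suminf\<close> is the true sum.\<close>

definition A_H :: "real \<Rightarrow> real \<Rightarrow> (nat \<Rightarrow> real) normed_alg"
  where "A_H t r = \<lparr>
    carrier = {f. summable (\<lambda>n. \<bar>f n / falling_fact t n\<bar> * r ^ n)},
    monoid.mult = boxplus t,
    one = (\<lambda>n. if n = 0 then 1 else 0),
    ring.zero = (\<lambda>n. 0),
    add = (\<lambda>f g n. f n + g n),
    module.smult = (\<lambda>c f n. c * f n),
    nrm = (\<lambda>f. \<Sum>n. \<bar>f n / falling_fact t n\<bar> * r ^ n)\<rparr>"

section \<open>The weighted Wiener algebra\<close>

definition Wiener :: "real \<Rightarrow> real fps normed_alg"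
  where "Wiener r = \<lparr>
    carrier = {F. summable (\<lambda>n. \<bar>fps_nth F n\<bar> * r ^ n)},
    monoid.mult = (\<lambda>F G. F * G),
    one = 1,
    ring.zero = 0,
    add = (\<lambda>F G. F + G),
    module.smult = (\<lambda>c F. fps_const c * F),
    nrm = (\<lambda>F. \<Sum>n. \<bar>fps_nth F n\<bar> * r ^ n)\<rparr>"

end

theory Submission
  imports Defs
begin

text \<open>Rescaling by the nonvanishing falling factorials turns \<open>boxplus t\<close> into the Cauchy product,
  so \<open>Phi t\<close> is injective on all sequences and every algebraic identity can be pulled back from
  formal power series. The norm estimates and completeness are those of the weighted
  \<open>\<ell>\<^sup>1\<close>-space of coefficients.\<close>

section \<open>Membership, operations and norms of the two records\<close>

lemma Wiener_sel [simp]: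
  "F \<in> carrier (Wiener r) \<longleftrightarrow> summable (\<lambda>n. \<bar>fps_nth F n\<bar> * r ^ n)"
  "\<one>\<^bsub>Wiener r\<^esub> = 1" "\<zero>\<^bsub>Wiener r\<^esub> = 0" "F \<otimes>\<^bsub>Wiener r\<^esub> G = F * G" "F \<oplus>\<^bsub>Wiener r\<^esub> G = F + G"
  "c \<odot>\<^bsub>Wiener r\<^esub> F = fps_const c * F"
  by (simp_all add: Wiener_def)

text \<open>Both the summability condition and the norm of \<open>A_H t r\<close> are those of the
  coefficients of \<open>Phi t f\<close>, so as rewrite rules these equations turn membership and
  norm questions about sequences into questions about power series.\<close>

lemma A_H_sel [simp]:
  "f \<in> carrier (A_H t r) \<longleftrightarrow> Phi t f \<in> carrier (Wiener r)"
  "\<one>\<^bsub>A_H t r\<^esub> = (\<lambda>n. if n = 0 then 1 else 0)" "\<zero>\<^bsub>A_H t r\<^esub> = (\<lambda>n. 0)"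
  "f \<otimes>\<^bsub>A_H t r\<^esub> g = boxplus t f g" "f \<oplus>\<^bsub>A_H t r\<^esub> g = (\<lambda>n. f n + g n)"
  "c \<odot>\<^bsub>A_H t r\<^esub> f = (\<lambda>n. c * f n)"
  "\<parallel>f\<parallel>\<^bsub>A_H t r\<^esub> = \<parallel>Phi t f\<parallel>\<^bsub>Wiener r\<^esub>"
  by (simp_all add: A_H_def Phi_def Wiener_def)

lemma nrm_Wiener: "\<parallel>F\<parallel>\<^bsub>Wiener r\<^esub> = (\<Sum>n. \<bar>fps_nth F n\<bar> * r ^ n)"
  by (simp add: Wiener_def)

section \<open>Norm estimates in the weighted Wiener algebra\<close>

context
  fixes r :: real
  assumes r: "r > 0"
begin

lemma Wiener_add:
  assumes "F \<in> carrier (Wiener r)" "G \<in> carrier (Wiener r)"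
  shows "F + G \<in> carrier (Wiener r)"
    and "\<parallel>F + G\<parallel>\<^bsub>Wiener r\<^esub> \<le> \<parallel>F\<parallel>\<^bsub>Wiener r\<^esub> + \<parallel>G\<parallel>\<^bsub>Wiener r\<^esub>"
proof -
  let ?s = "\<lambda>n. \<bar>fps_nth F n\<bar> * r ^ n + \<bar>fps_nth G n\<bar> * r ^ n"
  have s: "summable ?s"
    using assms by (simp add: summable_add)
  have le: "\<bar>fps_nth (F + G) n\<bar> * r ^ n \<le> ?s n" for n
    using r by (simp flip: distrib_right add: mult_right_mono abs_triangle_ineq)
  show mem: "F + G \<in> carrier (Wiener r)"
    unfolding Wiener_sel by (rule summable_comparison_test'[OF s, of 0]) (use r le in auto)
  have "\<parallel>F + G\<parallel>\<^bsub>Wiener r\<^esub> \<le> suminf ?s"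
    unfolding nrm_Wiener using mem s le by (intro suminf_le) auto
  then show "\<parallel>F + G\<parallel>\<^bsub>Wiener r\<^esub> \<le> \<parallel>F\<parallel>\<^bsub>Wiener r\<^esub> + \<parallel>G\<parallel>\<^bsub>Wiener r\<^esub>"
    using assms by (simp add: nrm_Wiener suminf_add)
qed

lemma Wiener_smult:
  assumes "F \<in> carrier (Wiener r)"
  shows "fps_const c * F \<in> carrier (Wiener r)"
    and "\<parallel>fps_const c * F\<parallel>\<^bsub>Wiener r\<^esub> = \<bar>c\<bar> * \<parallel>F\<parallel>\<^bsub>Wiener r\<^esub>"
  using assms by (simp_all add: nrm_Wiener abs_mult mult.assoc summable_mult suminf_mult)

lemma Wiener_diff:
  assumes "F \<in> carrier (Wiener r)" "G \<in> carrier (Wiener r)"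
  shows "F - G \<in> carrier (Wiener r)"
proof -
  have "F - G = F + fps_const (- 1) * G"
    by (simp add: fps_eq_iff)
  then show ?thesis
    using Wiener_add(1) Wiener_smult(1) assms by metis
qed

text \<open>Since \<open>r ^ n\<close> splits as \<open>r ^ i * r ^ (n - i)\<close>, the weighted
  coefficients of \<open>F * G\<close> are dominated by the Cauchy product of two absolutely
  convergent series, whose sum is the product of the norms.\<close>

lemma Wiener_mult:
  assumes "F \<in> carrier (Wiener r)" "G \<in> carrier (Wiener r)"
  shows "F * G \<in> carrier (Wiener r)"
    and "\<parallel>F * G\<parallel>\<^bsub>Wiener r\<^esub> \<le> \<parallel>F\<parallel>\<^bsub>Wiener r\<^esub> * \<parallel>G\<parallel>\<^bsub>Wiener r\<^esub>"
proof -
  let ?a = "\<lambda>n. \<bar>fps_nth F n\<bar> * r ^ n" and ?b = "\<lambda>n. \<bar>fps_nth G n\<bar> * r ^ n"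
  let ?c = "\<lambda>n. \<Sum>i\<le>n. ?a i * ?b (n - i)"
  have ab: "summable (\<lambda>n. norm (?a n))" "summable (\<lambda>n. norm (?b n))"
    using assms r by (simp_all add: abs_mult)
  have le: "\<bar>fps_nth (F * G) n\<bar> * r ^ n \<le> ?c n" for n
  proof -
    have "\<bar>fps_nth (F * G) n\<bar> * r ^ n
        \<le> (\<Sum>i\<le>n. \<bar>fps_nth F i * fps_nth G (n - i)\<bar>) * r ^ n"
      unfolding fps_mult_nth atLeast0AtMost using r by (intro mult_right_mono sum_abs) auto
    also have "\<dots> = ?c n"
      by (auto simp: sum_distrib_right abs_mult simp flip: power_add intro!: sum.cong)
    finally show ?thesis .
  qed
  have s: "summable ?c"
    by (rule summable_Cauchy_product[OF ab])
  show mem: "F * G \<in> carrier (Wiener r)"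
    unfolding Wiener_sel by (rule summable_comparison_test'[OF s, of 0]) (use r le in auto)
  have "\<parallel>F * G\<parallel>\<^bsub>Wiener r\<^esub> \<le> suminf ?c"
    unfolding nrm_Wiener using mem s le by (intro suminf_le) auto
  then show "\<parallel>F * G\<parallel>\<^bsub>Wiener r\<^esub> \<le> \<parallel>F\<parallel>\<^bsub>Wiener r\<^esub> * \<parallel>G\<parallel>\<^bsub>Wiener r\<^esub>"
    unfolding nrm_Wiener Cauchy_product[OF ab] .
qed

lemma Wiener_one:
  shows "1 \<in> carrier (Wiener r)" and "\<parallel>1\<parallel>\<^bsub>Wiener r\<^esub> = 1"
proof -
  have "(\<lambda>n. \<bar>fps_nth 1 n\<bar> * r ^ n) sums (\<Sum>n\<in>{0}. \<bar>fps_nth 1 n\<bar> * r ^ n)"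
    by (rule sums_finite) auto
  then show "1 \<in> carrier (Wiener r)" and "\<parallel>1\<parallel>\<^bsub>Wiener r\<^esub> = 1"
    by (auto simp: nrm_Wiener sums_iff)
qed

lemma nrm_Wiener_nonneg:
  assumes "F \<in> carrier (Wiener r)"
  shows "0 \<le> \<parallel>F\<parallel>\<^bsub>Wiener r\<^esub>"
  unfolding nrm_Wiener using assms r by (intro suminf_nonneg) auto

lemma nrm_Wiener_eq_0_iff:
  assumes "F \<in> carrier (Wiener r)"
  shows "\<parallel>F\<parallel>\<^bsub>Wiener r\<^esub> = 0 \<longleftrightarrow> F = 0"
  unfolding nrm_Wiener using assms r by (subst suminf_eq_zero_iff) (auto simp: fps_eq_iff)

section \<open>Completeness of the weighted Wiener algebra\<close>

lemma sum_le_nrm_Wiener: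
  assumes "F \<in> carrier (Wiener r)"
  shows "(\<Sum>n<N. \<bar>fps_nth F n\<bar> * r ^ n) \<le> \<parallel>F\<parallel>\<^bsub>Wiener r\<^esub>"
  unfolding nrm_Wiener using assms r by (intro sum_le_suminf) auto

text \<open>The terms are nonnegative, so bounded partial sums give summability and the norm bound
  together. This suits a coefficientwise limit, whose membership is not known beforehand.\<close>

lemma Wiener_le:
  assumes "\<And>N. (\<Sum>n<N. \<bar>fps_nth F n\<bar> * r ^ n) \<le> c"
  shows "F \<in> carrier (Wiener r)" and "\<parallel>F\<parallel>\<^bsub>Wiener r\<^esub> \<le> c"
proof -
  show mem: "F \<in> carrier (Wiener r)"
    \<comment> \<open>\<open>bounded_imp_summable\<close> asks for sums that include the last index,
      hence the passage to \<open>{..<Suc n}\<close>.\<close>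
    unfolding Wiener_sel by (rule bounded_imp_summable[of _ c]) (use r assms in \<open>auto simp del: sum.lessThan_Suc simp flip: lessThan_Suc_atMost\<close>)
  show "\<parallel>F\<parallel>\<^bsub>Wiener r\<^esub> \<le> c"
    unfolding nrm_Wiener using mem assms by (intro suminf_le_const) auto
qed

text \<open>Each coefficient sequence is Cauchy in the reals, and bounds on partial sums survive the
  coefficientwise limit. The explicit epsilons let the result apply to the images under
  \<open>Phi t\<close> of a Cauchy sequence in \<open>A_H t r\<close>.\<close>

lemma Wiener_complete:
  fixes F :: "nat \<Rightarrow> real fps"
  assumes mem: "\<And>k. F k \<in> carrier (Wiener r)"
    and cauchy: "\<And>e. e > 0 \<Longrightarrow> \<exists>K. \<forall>k\<ge>K. \<forall>m\<ge>K. \<parallel>F k - F m\<parallel>\<^bsub>Wiener r\<^esub> < e"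
  obtains G where "G \<in> carrier (Wiener r)"
    and "\<And>e. e > 0 \<Longrightarrow> \<exists>K. \<forall>k\<ge>K. \<parallel>F k - G\<parallel>\<^bsub>Wiener r\<^esub> < e"
proof -
  note diff = Wiener_diff[OF mem mem]
  have "convergent (\<lambda>k. fps_nth (F k) n)" for n
  proof (rule Cauchy_convergent, rule metric_CauchyI)
    fix e :: real
    assume "e > 0"
    \<comment> \<open>A single weighted coefficient is at most the norm, so the tolerance
      \<open>e * r ^ n\<close> leaves \<open>e\<close> after cancelling
      \<open>r ^ n\<close>.\<close>
    then obtain K where K: "\<forall>k\<ge>K. \<forall>m\<ge>K. \<parallel>F k - F m\<parallel>\<^bsub>Wiener r\<^esub> < e * r ^ n"
      using cauchy[of "e * r ^ n"] r by auto
    have "dist (fps_nth (F k) n) (fps_nth (F m) n) < e" if "k \<ge> K" "m \<ge> K" for k m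
    proof -
      have "\<bar>fps_nth (F k - F m) n\<bar> * r ^ n \<le> (\<Sum>i<Suc n. \<bar>fps_nth (F k - F m) i\<bar> * r ^ i)"
        by (rule member_le_sum) (use r in auto)
      also have "\<dots> \<le> \<parallel>F k - F m\<parallel>\<^bsub>Wiener r\<^esub>"
        by (rule sum_le_nrm_Wiener[OF diff])
      also have "\<dots> < e * r ^ n"
        using K that by blast
      finally show ?thesis
        using r by (simp add: dist_real_def)
    qed
    then show "\<exists>K. \<forall>k\<ge>K. \<forall>m\<ge>K. dist (fps_nth (F k) n) (fps_nth (F m) n) < e"
      by blast
  qed
  then obtain g where g: "\<And>n. (\<lambda>k. fps_nth (F k) n) \<longlonglongrightarrow> g n"
    unfolding convergent_def by metis
  define G where "G = Abs_fps g"
  have close: "\<exists>K. \<forall>k\<ge>K. F k - G \<in> carrier (Wiener r) \<and> \<parallel>F k - G\<parallel>\<^bsub>Wiener r\<^esub> < e"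
    if e: "e > 0" for e
  proof -
    \<comment> \<open>Limits preserve only non-strict inequalities; aiming at \<open>e / 2\<close>
      recovers a strict bound by \<open>e\<close>.\<close>
    obtain K where K: "\<forall>k\<ge>K. \<forall>m\<ge>K. \<parallel>F k - F m\<parallel>\<^bsub>Wiener r\<^esub> < e / 2"
      using cauchy[of "e / 2"] e by auto
    have "(\<Sum>n<N. \<bar>fps_nth (F k - G) n\<bar> * r ^ n) \<le> e / 2" if k: "k \<ge> K" for k N
    \<comment> \<open>With \<open>k\<close> and \<open>N\<close> fixed, \<open>m\<close> tends to
      infinity: the finite sum allows termwise limits, and the bound does not depend on
      \<open>N\<close>.\<close>
    proof (rule LIMSEQ_le_const2)
      show "(\<lambda>m. \<Sum>n<N. \<bar>fps_nth (F k - F m) n\<bar> * r ^ n)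
          \<longlonglongrightarrow> (\<Sum>n<N. \<bar>fps_nth (F k - G) n\<bar> * r ^ n)"
        by (auto simp: G_def intro!: tendsto_intros g)
      show "\<exists>M. \<forall>m\<ge>M. (\<Sum>n<N. \<bar>fps_nth (F k - F m) n\<bar> * r ^ n) \<le> e / 2"
        using K k sum_le_nrm_Wiener[OF diff] by (meson order.trans less_imp_le)
    qed
    from Wiener_le[OF this] e show ?thesis
      by (metis field_sum_of_halves less_add_same_cancel1 half_gt_zero order.strict_trans1)
  qed
  obtain k where k: "F k - G \<in> carrier (Wiener r)"
    using close[of 1] by auto
  show ?thesis
  proof
    \<comment> \<open>\<open>G\<close> equals \<open>F k - (F k - G)\<close>, a difference of two
      members.\<close>
    show "G \<in> carrier (Wiener r)"
      using Wiener_diff[OF mem[of k] k] by simp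
  qed (use close in blast)
qed

end

section \<open>Transport along the rescaling\<close>

lemma Phi_add: "Phi t (\<lambda>n. f n + g n) = Phi t f + Phi t g"
  by (simp add: Phi_def fps_eq_iff add_divide_distrib)

lemma Phi_smult: "Phi t (\<lambda>n. c * f n) = fps_const c * Phi t f"
  by (simp add: Phi_def fps_eq_iff)

lemma Phi_zero: "Phi t (\<lambda>n. 0) = 0"
  by (simp add: Phi_def fps_eq_iff)

lemma Phi_one: "Phi t (\<lambda>n. if n = 0 then 1 else 0) = 1"
  by (simp add: Phi_def fps_eq_iff falling_fact_def)

context
  fixes t :: real
  assumes t: "t \<notin> \<nat>"
begin

text \<open>A vanishing factor \<open>t - real i\<close> would make \<open>t\<close> a natural
  number.\<close>

lemma falling_fact_nonzero: "falling_fact t n \<noteq> 0"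
  using t by (auto simp: falling_fact_def)

text \<open>Dividing the \<open>n\<close>-th term of the twisted convolution by
  \<open>falling_fact t n\<close> cancels the numerator of the weight; its denominators are exactly
  the rescalings of the two factors.\<close>

lemma Phi_boxplus: "Phi t (boxplus t f g) = Phi t f * Phi t g"
  by (auto simp: Phi_def fps_eq_iff fps_mult_nth boxplus_def atLeast0AtMost sum_divide_distrib
      falling_fact_nonzero intro!: sum.cong)

text \<open>An explicit preimage of every power series; it supplies surjectivity and pulls limits
  back to sequences.\<close>

lemma Phi_Abs: "Phi t (\<lambda>n. falling_fact t n * fps_nth F n) = F"
  by (simp add: Phi_def fps_eq_iff falling_fact_nonzero)

lemma Phi_eq_iff: "Phi t f = Phi t g \<longleftrightarrow> f = g"
  by (auto simp: Phi_def fps_eq_iff falling_fact_nonzero)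

lemmas Phi_hom = Phi_add Phi_smult Phi_zero Phi_one Phi_boxplus

section \<open>Algebra, norm and completeness on the sequence side\<close>

context
  fixes r :: real
  assumes r: "r > 0"
begin

lemma abelian_group_A_H: "abelian_group (A_H t r)"
proof (rule abelian_groupI)
  fix f
  assume "f \<in> carrier (A_H t r)"
  \<comment> \<open>The additive inverse is written as a scalar multiple so that its membership is a
    case of \<open>Wiener_smult\<close>.\<close>
  then have "(\<lambda>n. -1 * f n) \<in> carrier (A_H t r)"
    unfolding A_H_sel Phi_smult using Wiener_smult(1)[OF r] by blast
  then show "\<exists>g\<in>carrier (A_H t r). g \<oplus>\<^bsub>A_H t r\<^esub> f = \<zero>\<^bsub>A_H t r\<^esub>"
    by (intro bexI) auto
\<comment> \<open>Removing \<open>Wiener_sel(1)\<close> keeps membership folded, so that the closure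
  facts for \<open>Wiener r\<close> match.\<close>
qed (use Wiener_add(1)[OF r] in \<open>auto simp: Phi_hom algebra_simps simp del: Wiener_sel(1)\<close>, simp)

lemma cring_A_H: "cring (A_H t r)"
proof (rule cringI[OF abelian_group_A_H])
  show "comm_monoid (A_H t r)"
    by (rule comm_monoidI)
      (use Wiener_mult(1)[OF r] Wiener_one(1)[OF r] in
        \<open>auto simp: Phi_hom mult_ac simp del: Wiener_sel(1) simp flip: Phi_eq_iff\<close>)
qed (simp add: Phi_hom algebra_simps flip: Phi_eq_iff)

lemma algebra_A_H: "algebra (ring_of_type_algebra :: real ring) (A_H t r)"
proof -
  interpret R: cring "ring_of_type_algebra :: real ring"
    by (rule cring_from_type_algebra)
  interpret M: cring "A_H t r"
    by (rule cring_A_H)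
  show ?thesis
  proof
    show "(c \<odot>\<^bsub>A_H t r\<^esub> f) \<otimes>\<^bsub>A_H t r\<^esub> g = c \<odot>\<^bsub>A_H t r\<^esub> (f \<otimes>\<^bsub>A_H t r\<^esub> g)" for c f g
      unfolding A_H_sel by (simp only: Phi_hom mult.assoc flip: Phi_eq_iff)
    show "c \<odot>\<^bsub>A_H t r\<^esub> f \<in> carrier (A_H t r)" if "f \<in> carrier (A_H t r)" for c f
      using that unfolding A_H_sel Phi_smult by (rule Wiener_smult(1)[OF r])
  qed (simp_all add: ring_of_type_algebra_def algebra_simps del: A_H_sel(1))
qed

lemma comm_normed_algebra_A_H: "comm_normed_algebra (A_H t r)"
proof -
  interpret algebra "ring_of_type_algebra :: real ring" "A_H t r"
    by (rule algebra_A_H)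
  show ?thesis
    by unfold_locales
      (use nrm_Wiener_nonneg[OF r] nrm_Wiener_eq_0_iff[OF r] Wiener_add[OF r] Wiener_smult[OF r]
        Wiener_mult[OF r] Wiener_one[OF r] in
        \<open>simp_all add: Phi_hom del: Wiener_sel(1) flip: Phi_eq_iff\<close>)
qed

text \<open>Subtraction in a record rests on an abstractly defined inverse, so it does not unfold to
  a pointwise formula. It is instead characterized by adding \<open>g\<close> back, and
  \<open>Phi t\<close> is additive.\<close>

lemma Phi_a_minus:
  assumes "f \<in> carrier (A_H t r)" "g \<in> carrier (A_H t r)"
  shows "Phi t (f \<ominus>\<^bsub>A_H t r\<^esub> g) = Phi t f - Phi t g"
proof -
  interpret abelian_group "A_H t r"
    by (rule abelian_group_A_H)
  have "(f \<ominus>\<^bsub>A_H t r\<^esub> g) \<oplus>\<^bsub>A_H t r\<^esub> g = f"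
    using assms by (simp add: a_minus_def a_assoc l_neg del: A_H_sel)
  then have "Phi t (f \<ominus>\<^bsub>A_H t r\<^esub> g) + Phi t g = Phi t f"
    unfolding A_H_sel(5) by (simp only: flip: Phi_add)
  then show ?thesis
    by (simp only: eq_diff_eq)
qed

lemma comm_banach_algebra_A_H: "comm_banach_algebra (A_H t r)"
proof -
  interpret comm_normed_algebra "A_H t r"
    by (rule comm_normed_algebra_A_H)
  \<comment> \<open>\<open>nrm_dist\<close> is cut off outside the carrier, so both memberships are
    needed before it becomes the distance in \<open>Wiener r\<close>.\<close>
  have dist: "nrm_dist f g = \<parallel>Phi t f - Phi t g\<parallel>\<^bsub>Wiener r\<^esub>"
    if "f \<in> carrier (A_H t r)" "g \<in> carrier (A_H t r)" for f g
    using that Phi_a_minus[OF that] by (simp only: nrm_dist_def A_H_sel(7) simp_thms if_True)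
  have mcomplete
    unfolding mcomplete_def
  proof (intro allI impI)
    fix f
    assume "MCauchy f"
    then have mem: "\<And>k. f k \<in> carrier (A_H t r)"
      and cauchy: "\<And>e. e > 0 \<Longrightarrow> \<exists>K. \<forall>k\<ge>K. \<forall>m\<ge>K. nrm_dist (f k) (f m) < e"
      unfolding MCauchy_def by (blast, meson)
    obtain G where G: "G \<in> carrier (Wiener r)"
      and lim: "\<And>e. e > 0 \<Longrightarrow> \<exists>K. \<forall>k\<ge>K. \<parallel>Phi t (f k) - G\<parallel>\<^bsub>Wiener r\<^esub> < e"
      using Wiener_complete[OF r, of "\<lambda>k. Phi t (f k)"] mem cauchy
      unfolding A_H_sel(1)[symmetric] dist[OF mem mem] by metis
    obtain g where g: "Phi t g = G"
      using Phi_Abs by metis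
    with G have gmem: "g \<in> carrier (A_H t r)"
      by (simp del: Wiener_sel(1))
    have "limitin mtopology f g sequentially"
      unfolding limitin_metric eventually_sequentially
      using gmem mem lim dist[OF mem gmem] g by auto
    then show "\<exists>g. limitin mtopology f g sequentially"
      by blast
  qed
  then show ?thesis
    by unfold_locales
qed

lemma Phi_isometric_algebra_iso: "Phi t \<in> isometric_algebra_iso (A_H t r) (Wiener r)"
proof -
  have "bij_betw (Phi t) (carrier (A_H t r)) (carrier (Wiener r))"
    unfolding bij_betw_def
  proof
    show "inj_on (Phi t) (carrier (A_H t r))"
      by (simp only: inj_on_def Phi_eq_iff) blast
    show "Phi t ` carrier (A_H t r) = carrier (Wiener r)"
    proof (intro equalityI subsetI)
      fix F
      assume F: "F \<in> carrier (Wiener r)"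
      show "F \<in> Phi t ` carrier (A_H t r)"
        by (rule image_eqI[where f = "Phi t", OF Phi_Abs[symmetric]]) (use F in \<open>simp only: A_H_sel Phi_Abs\<close>)
    qed (auto simp del: Wiener_sel)
  qed
  moreover have "Phi t \<in> ring_hom (A_H t r) (Wiener r)"
    by (rule ring_hom_memI) (simp_all only: A_H_sel Wiener_sel(2-) Phi_hom)
  ultimately show ?thesis
    unfolding isometric_algebra_iso_def ring_iso_def
    \<comment> \<open>The isometry condition becomes an identity once \<open>A_H_sel\<close>
      expresses the norm of \<open>A_H t r\<close> through \<open>Phi t\<close>.\<close>
    by (simp only: mem_Collect_eq A_H_sel Wiener_sel(6) Phi_smult ball_triv simp_thms)
qed

end

end

theorem proposition5p1:
  fixes t r :: real
  assumes "t \<notin> \<nat>" and "r > 0"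
  shows "comm_banach_algebra (A_H t r) \<and>
         Phi t \<in> isometric_algebra_iso (A_H t r) (Wiener r)"
  using comm_banach_algebra_A_H[OF assms] Phi_isometric_algebra_iso[OF assms] ..

end
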